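(* Let $X\neq\{0\}$ be a Banach space and let $p,q\in\mathcal{N}(X)$ be equivalent norms on $X$. If $C=\mathbb{R}^X_+$, then $$M_C(q/p)=M_{\log}(q/p),\qquad m_C(q/p)=m_{\log}(q/p).$$ Consequently, the Hilbert projective metric induced by $\mathbb{R}^X_+$ on $\mathcal{N}'(X)$ coincides with the symmetric logarithmic metric; that is, $d_C([p],[q])=d_{\log}([p],[q])$ for every $p,q\in\mathcal{N}(X)$.
   Context: $\mathcal{N}(X)$ is the set of all norms on $X$ equivalent to the given norm of the Banach space $X$. $\mathcal{N}'(X)$ is its projectivization: the set of classes $[p]$ under $p\sim q$ iff $q=\lambda p$ for some $\lambda>0$. $\mathbb{R}^X_+$ is the set of all functions $f:X\to\mathbb{R}$ with $f(x)\ge 0$ for every $x\in X$; it is a cone in the real vector space of functions $X\to\mathbb{R}$. A cone in a real vector space $V$ is a nonempty convex set $C\subset V$ with $\lambda C\subset C$ for all $\lambda>0$ and $C\cap(-C)\subset\{0\}$. It induces the relation $u\preceq_C v$ iff $v-u\in C$. Nonzero $u,v\in C$ are comparable if $\alpha u\preceq_C v\preceq_C\beta u$ for some $\alpha,\beta>0$. For comparable $u,v$, set $m_C(v/u)=\sup\{\alpha>0\mid\alpha u\preceq_C v\}$, $M_C(v/u)=\inf\{\beta>0\mid v\preceq_C\beta u\}$ and $d_C([u],[v])=d_C(u,v)=\log\frac{M_C(v/u)}{m_C(v/u)}$ (and $d_C=\infty$ for nonzero non-comparable elements). For $p,q\in\mathcal{N}(X)$, $M_{\log}(q/p)=\sup_{x\ne0}\frac{q(x)}{p(x)}$,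 $m_{\log}(q/p)=\inf_{x\neq0}\frac{q(x)}{p(x)}$, and $d_{\log}([p],[q])=\log\frac{M_{\log}(q/p)}{m_{\log}(q/p)}$. *)

theory Defs
  imports "HOL-Analysis.Analysis" "HOL-Library.Function_Algebras"
begin

section \<open>The real vector space of functions\<close>

instantiation "fun" :: (type, scaleR) scaleR
begin

definition "r *\<^sub>R f = (\<lambda>x. r *\<^sub>R f x)"
instance ..

end

lemma scaleR_fun_apply [simp]: "(r *\<^sub>R f) x = r *\<^sub>R f x"
  by (simp add: scaleR_fun_def)

instance "fun" :: (type, real_vector) real_vector
  by standard (simp_all add: fun_eq_iff scaleR_add_right scaleR_add_left)


section \<open>Cones and the Hilbert projective metric\<close>

text \<open>The library predicate \<open>cone\<close> is different: it allows the empty set, requires neither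
  convexity nor pointedness, and asks for closure under multiplication by \<open>0\<close>.\<close>

definition pointed_convex_cone :: "'v::real_vector set \<Rightarrow> bool" where
  "pointed_convex_cone C \<longleftrightarrow>
     C \<noteq> {} \<and> convex C \<and> (\<forall>l>0. (*\<^sub>R) l ` C \<subseteq> C) \<and> C \<inter> uminus ` C \<subseteq> {0}"

definition cone_le :: "'v::real_vector set \<Rightarrow> 'v \<Rightarrow> 'v \<Rightarrow> bool" where
  "cone_le C u v \<longleftrightarrow> v - u \<in> C"

definition cone_comparable :: "'v::real_vector set \<Rightarrow> 'v \<Rightarrow> 'v \<Rightarrow> bool" where
  "cone_comparable C u v \<longleftrightarrow>
     u \<in> C \<and> v \<in> C \<and> u \<noteq> 0 \<and> v \<noteq> 0 \<and>
     (\<exists>\<alpha>>0. \<exists>\<beta>>0. cone_le C (\<alpha> *\<^sub>R u) v \<and> cone_le C v (\<beta> *\<^sub>R u))"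

text \<open>The argument order follows the fractions: \<open>cone_m C v u\<close> is $m_C(v/u)$ and \<open>cone_M C v u\<close>
  is $M_C(v/u)$. For comparable \<open>u\<close>, \<open>v\<close> both sets below are nonempty and the first is bounded
  above, by pointedness; hence real suprema and infima suffice.\<close>

definition cone_m :: "'v::real_vector set \<Rightarrow> 'v \<Rightarrow> 'v \<Rightarrow> real" where
  "cone_m C v u = Sup {\<alpha>. \<alpha> > 0 \<and> cone_le C (\<alpha> *\<^sub>R u) v}"

definition cone_M :: "'v::real_vector set \<Rightarrow> 'v \<Rightarrow> 'v \<Rightarrow> real" where
  "cone_M C v u = Inf {\<beta>. \<beta> > 0 \<and> cone_le C v (\<beta> *\<^sub>R u)}"

definition hilbert_dist :: "'v::real_vector set \<Rightarrow> 'v \<Rightarrow> 'v \<Rightarrow> ereal" where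
  "hilbert_dist C u v =
     (if cone_comparable C u v then ereal (ln (cone_M C v u / cone_m C v u)) else \<infinity>)"

definition proj_rel :: "('v::real_vector \<times> 'v) set" where
  "proj_rel = {(u, v). \<exists>l>0. v = l *\<^sub>R u}"

definition proj_class :: "'v::real_vector \<Rightarrow> 'v set" where
  "proj_class u = proj_rel `` {u}"

text \<open>The value of \<open>f\<close> on representatives; meaningful when it does not depend on their choice,
  as is verified below for \<open>hilbert_dist\<close> and \<open>log_dist\<close>.\<close>

definition lift_proj :: "('v \<Rightarrow> 'v \<Rightarrow> 'b) \<Rightarrow> 'v set \<Rightarrow> 'v set \<Rightarrow> 'b" where
  "lift_proj f A B = the_elem (\<Union>u\<in>A. \<Union>v\<in>B. {f u v})"

definition hilbert_metric :: "'v::real_vector set \<Rightarrow> 'v set \<Rightarrow> 'v set \<Rightarrow> ereal" where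
  "hilbert_metric C = lift_proj (hilbert_dist C)"


section \<open>Equivalent norms and the symmetric logarithmic metric\<close>

definition is_norm :: "('a::real_vector \<Rightarrow> real) \<Rightarrow> bool" where
  "is_norm p \<longleftrightarrow>
     (\<forall>x. p x \<ge> 0) \<and> (\<forall>x. p x = 0 \<longleftrightarrow> x = 0) \<and>
     (\<forall>a x. p (a *\<^sub>R x) = \<bar>a\<bar> * p x) \<and> (\<forall>x y. p (x + y) \<le> p x + p y)"

definition equiv_norms :: "('a::real_normed_vector \<Rightarrow> real) set" where
  "equiv_norms = {p. is_norm p \<and> (\<exists>a>0. \<exists>b>0. \<forall>x. a * norm x \<le> p x \<and> p x \<le> b * norm x)}"

definition proj_equiv_norms :: "('a::real_normed_vector \<Rightarrow> real) set set" where
  "proj_equiv_norms = equiv_norms // proj_rel"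

definition nonneg_funs :: "('a \<Rightarrow> real) set" where
  "nonneg_funs = {f. \<forall>x. f x \<ge> 0}"

definition log_M :: "('a::real_normed_vector \<Rightarrow> real) \<Rightarrow> ('a \<Rightarrow> real) \<Rightarrow> real" where
  "log_M q p = (SUP x\<in>{x. x \<noteq> 0}. q x / p x)"

definition log_m :: "('a::real_normed_vector \<Rightarrow> real) \<Rightarrow> ('a \<Rightarrow> real) \<Rightarrow> real" where
  "log_m q p = (INF x\<in>{x. x \<noteq> 0}. q x / p x)"

definition log_dist :: "('a::real_normed_vector \<Rightarrow> real) \<Rightarrow> ('a \<Rightarrow> real) \<Rightarrow> real" where
  "log_dist p q = ln (log_M q p / log_m q p)"

definition log_metric :: "('a::real_normed_vector \<Rightarrow> real) set \<Rightarrow> ('a \<Rightarrow> real) set \<Rightarrow> real" where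
  "log_metric = lift_proj log_dist"


section \<open>Well-definedness\<close>

lemma pointed_convex_cone_nonneg_funs: "pointed_convex_cone (nonneg_funs :: ('a \<Rightarrow> real) set)"
proof -
  have "(\<lambda>_. 0) \<in> (nonneg_funs :: ('a \<Rightarrow> real) set)" by (simp add: nonneg_funs_def)
  then have "nonneg_funs \<noteq> ({} :: ('a \<Rightarrow> real) set)" by blast
  moreover have "convex (nonneg_funs :: ('a \<Rightarrow> real) set)"
    by (auto simp: convex_def nonneg_funs_def)
  moreover have "nonneg_funs \<inter> uminus ` nonneg_funs \<subseteq> ({0} :: ('a \<Rightarrow> real) set)"
    by (auto simp: nonneg_funs_def intro!: ext antisym)
  ultimately show ?thesis
    by (auto simp: pointed_convex_cone_def nonneg_funs_def)
qed

lemma equiv_proj_rel: "equiv UNIV (proj_rel :: ('v::real_vector \<times> 'v) set)"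
proof (rule equivI)
  show "refl (proj_rel :: ('v \<times> 'v) set)"
    by (auto simp: refl_on_def proj_rel_def intro: exI[of _ 1])
  show "sym (proj_rel :: ('v \<times> 'v) set)"
  proof (rule symI)
    fix u v :: 'v assume "(u, v) \<in> proj_rel"
    then obtain l where "l > 0" "v = l *\<^sub>R u" by (auto simp: proj_rel_def)
    then have "1 / l > 0" "u = (1 / l) *\<^sub>R v" by auto
    then show "(v, u) \<in> proj_rel" by (auto simp only: proj_rel_def)
  qed
  show "trans (proj_rel :: ('v \<times> 'v) set)"
    by (rule transI) (auto simp: proj_rel_def intro: mult_pos_pos)
qed auto

lemma lift_proj_eq:
  assumes "\<And>a b. a > 0 \<Longrightarrow> b > 0 \<Longrightarrow> f (a *\<^sub>R u) (b *\<^sub>R v) = f u v"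
  shows "lift_proj f (proj_class u) (proj_class v) = f u v"
proof -
  have "u \<in> proj_class u" "v \<in> proj_class v"
    by (auto simp: proj_class_def proj_rel_def intro: exI[of _ 1])
  moreover have "f u' v' = f u v" if "u' \<in> proj_class u" "v' \<in> proj_class v" for u' v'
    using that assms by (auto simp: proj_class_def proj_rel_def)
  ultimately have "(\<Union>u'\<in>proj_class u. \<Union>v'\<in>proj_class v. {f u' v'}) = {f u v}" by blast
  then show ?thesis by (simp add: lift_proj_def)
qed

lemma cone_scaleR_iff:
  assumes "pointed_convex_cone C" "l > 0"
  shows "l *\<^sub>R w \<in> C \<longleftrightarrow> w \<in> C"
proof
  assume "l *\<^sub>R w \<in> C"
  then have "(1 / l) *\<^sub>R (l *\<^sub>R w) \<in> C"
    using assms unfolding pointed_convex_cone_def by (meson imageI subsetD zero_less_divide_1_iff)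
  then show "w \<in> C" using assms by simp
next
  assume "w \<in> C" then show "l *\<^sub>R w \<in> C"
    using assms unfolding pointed_convex_cone_def by (meson imageI subsetD)
qed

lemma cone_le_scaleR:
  assumes "pointed_convex_cone C" "a > 0" "b > 0"
  shows "cone_le C (s *\<^sub>R a *\<^sub>R u) (b *\<^sub>R v) \<longleftrightarrow> cone_le C ((s * (a / b)) *\<^sub>R u) v"
    and "cone_le C (b *\<^sub>R v) (s *\<^sub>R a *\<^sub>R u) \<longleftrightarrow> cone_le C v ((s * (a / b)) *\<^sub>R u)"
proof -
  have "b *\<^sub>R v - s *\<^sub>R a *\<^sub>R u = b *\<^sub>R (v - (s * (a / b)) *\<^sub>R u)"
    using assms by (simp add: scaleR_diff_right)
  then show "cone_le C (s *\<^sub>R a *\<^sub>R u) (b *\<^sub>R v) \<longleftrightarrow> cone_le C ((s * (a / b)) *\<^sub>R u) v"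
    by (simp add: cone_le_def cone_scaleR_iff[OF assms(1,3)])
  have "s *\<^sub>R a *\<^sub>R u - b *\<^sub>R v = b *\<^sub>R ((s * (a / b)) *\<^sub>R u - v)"
    using assms by (simp add: scaleR_diff_right)
  then show "cone_le C (b *\<^sub>R v) (s *\<^sub>R a *\<^sub>R u) \<longleftrightarrow> cone_le C v ((s * (a / b)) *\<^sub>R u)"
    by (simp add: cone_le_def cone_scaleR_iff[OF assms(1,3)])
qed

lemma Collect_pos_scale:
  assumes "(c::real) > 0"
  shows "{s. s > 0 \<and> P (s * c)} = (*) (1 / c) ` {s. s > 0 \<and> P s}"
proof (intro set_eqI iffI)
  fix s assume "s \<in> {s. s > 0 \<and> P (s * c)}"
  then have "s * c \<in> {s. s > 0 \<and> P s}" "s = 1 / c * (s * c)" using assms by auto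
  then show "s \<in> (*) (1 / c) ` {s. s > 0 \<and> P s}" by (rule rev_image_eqI)
qed (use assms in auto)

lemma Sup_Inf_mult_pos:
  assumes "(c::real) > 0"
  shows "S \<noteq> {} \<Longrightarrow> bdd_above S \<Longrightarrow> Sup ((*) c ` S) = c * Sup S"
    and "S \<noteq> {} \<Longrightarrow> bdd_below S \<Longrightarrow> Inf ((*) c ` S) = c * Inf S"
proof -
  have "continuous (at_left (Sup S)) ((*) c)" "continuous (at_right (Inf S)) ((*) c)"
    by (intro continuous_intros)+
  moreover have "mono ((*) c)" using assms by (simp add: mono_def)
  ultimately show "S \<noteq> {} \<Longrightarrow> bdd_above S \<Longrightarrow> Sup ((*) c ` S) = c * Sup S"
    and "S \<noteq> {} \<Longrightarrow> bdd_below S \<Longrightarrow> Inf ((*) c ` S) = c * Inf S"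
    using continuous_at_Sup_mono[of "(*) c" S] continuous_at_Inf_mono[of "(*) c" S] by auto
qed

lemma cone_comparable_bdd_above:
  assumes C: "pointed_convex_cone C" and cmp: "cone_comparable C u v"
  shows "bdd_above {\<alpha>. \<alpha> > 0 \<and> cone_le C (\<alpha> *\<^sub>R u) v}"
proof -
  from cmp obtain \<beta> where u: "u \<in> C" "u \<noteq> 0" and b: "\<beta> *\<^sub>R u - v \<in> C"
    by (auto simp: cone_comparable_def cone_le_def)
  have "\<alpha> \<le> \<beta>" if a: "v - \<alpha> *\<^sub>R u \<in> C" for \<alpha>
  proof (rule ccontr)
    assume "\<not> \<alpha> \<le> \<beta>"
    have "convex C" using C by (simp add: pointed_convex_cone_def)
    then have "(1/2) *\<^sub>R (\<beta> *\<^sub>R u - v) + (1/2) *\<^sub>R (v - \<alpha> *\<^sub>R u) \<in> C"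
      by (rule convexD) (use a b in auto)
    also have "(1/2) *\<^sub>R (\<beta> *\<^sub>R u - v) + (1/2) *\<^sub>R (v - \<alpha> *\<^sub>R u) = ((\<alpha> - \<beta>) / 2) *\<^sub>R (- u)"
      by (simp add: algebra_simps diff_divide_distrib)
    finally have "- u \<in> C" using cone_scaleR_iff[OF C, of "(\<alpha> - \<beta>) / 2" "- u"] \<open>\<not> \<alpha> \<le> \<beta>\<close> by auto
    then have "u \<in> C \<inter> uminus ` C" using u by (auto intro: rev_image_eqI)
    then show False using C u by (auto simp: pointed_convex_cone_def)
  qed
  then show ?thesis by (auto simp: bdd_above_def cone_le_def)
qed

lemma cone_comparable_scaleR:
  assumes C: "pointed_convex_cone C" and ab: "a > 0" "b > 0"
  shows "cone_comparable C (a *\<^sub>R u) (b *\<^sub>R v) \<longleftrightarrow> cone_comparable C u v"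
proof -
  have *: "(\<exists>s>0. P (s * (a / b))) \<longleftrightarrow> (\<exists>s>0. P s)" for P
  proof
    assume "\<exists>s>0. P s" then obtain s where "s > 0" "P s" by blast
    then have "s * (b / a) > 0" "P (s * (b / a) * (a / b))" using ab by simp_all
    then show "\<exists>s>0. P (s * (a / b))" by blast
  next
    assume "\<exists>s>0. P (s * (a / b))" then show "\<exists>s>0. P s"
      using ab by (meson divide_pos_pos mult_pos_pos)
  qed
  have **: "cone_comparable C x y \<longleftrightarrow> x \<in> C \<and> y \<in> C \<and> x \<noteq> 0 \<and> y \<noteq> 0 \<and>
     (\<exists>\<alpha>>0. cone_le C (\<alpha> *\<^sub>R x) y) \<and> (\<exists>\<beta>>0. cone_le C y (\<beta> *\<^sub>R x))" for x y
    unfolding cone_comparable_def by blast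
  show ?thesis
    unfolding ** cone_le_scaleR[OF C ab] cone_scaleR_iff[OF C ab(1)] cone_scaleR_iff[OF C ab(2)]
    using ab *[of "\<lambda>s. cone_le C (s *\<^sub>R u) v"] *[of "\<lambda>s. cone_le C v (s *\<^sub>R u)"] by simp
qed

lemma hilbert_metric_proj_class:
  assumes C: "pointed_convex_cone C"
  shows "hilbert_metric C (proj_class u) (proj_class v) = hilbert_dist C u v"
  unfolding hilbert_metric_def
proof (rule lift_proj_eq)
  fix a b :: real assume ab: "a > 0" "b > 0"
  show "hilbert_dist C (a *\<^sub>R u) (b *\<^sub>R v) = hilbert_dist C u v"
  proof (cases "cone_comparable C u v")
    case True
    define c where "c = a / b"
    have c: "c > 0" using ab by (simp add: c_def)
    let ?A = "{\<alpha>. \<alpha> > 0 \<and> cone_le C (\<alpha> *\<^sub>R u) v}"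
    let ?B = "{\<beta>. \<beta> > 0 \<and> cone_le C v (\<beta> *\<^sub>R u)}"
    have ne: "?A \<noteq> {}" "?B \<noteq> {}" using True by (auto simp: cone_comparable_def)
    have bdd: "bdd_below ?B" by (rule bdd_belowI[of _ 0]) auto
    have "cone_m C (b *\<^sub>R v) (a *\<^sub>R u) = Sup ((*) (1 / c) ` ?A)"
      unfolding cone_m_def cone_le_scaleR[OF C ab] c_def[symmetric]
      by (subst Collect_pos_scale[OF c, of "\<lambda>s. cone_le C (s *\<^sub>R u) v"]) (rule refl)
    also have "\<dots> = 1 / c * cone_m C v u"
      unfolding cone_m_def
      by (rule Sup_Inf_mult_pos(1)) (use c ne cone_comparable_bdd_above[OF C True] in auto)
    finally have m: "cone_m C (b *\<^sub>R v) (a *\<^sub>R u) = 1 / c * cone_m C v u" .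
    have "cone_M C (b *\<^sub>R v) (a *\<^sub>R u) = Inf ((*) (1 / c) ` ?B)"
      unfolding cone_M_def cone_le_scaleR[OF C ab] c_def[symmetric]
      by (subst Collect_pos_scale[OF c, of "\<lambda>s. cone_le C v (s *\<^sub>R u)"]) (rule refl)
    also have "\<dots> = 1 / c * cone_M C v u"
      unfolding cone_M_def by (rule Sup_Inf_mult_pos(2)) (use c ne bdd in auto)
    finally have "cone_M C (b *\<^sub>R v) (a *\<^sub>R u) = 1 / c * cone_M C v u" .
    with m c show ?thesis
      by (simp add: hilbert_dist_def cone_comparable_scaleR[OF C ab])
  qed (simp add: hilbert_dist_def cone_comparable_scaleR[OF C ab])
qed

lemma equiv_norms_ratio_bounds:
  fixes p q :: "'a::real_normed_vector \<Rightarrow> real"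
  assumes "p \<in> equiv_norms" "q \<in> equiv_norms"
  obtains a b where "a > 0" "b > 0" "\<And>x. x \<noteq> 0 \<Longrightarrow> a \<le> q x / p x \<and> q x / p x \<le> b"
proof -
  from assms(1) obtain a b where p: "a > 0" "b > 0" "\<And>x. a * norm x \<le> p x \<and> p x \<le> b * norm x"
    by (auto simp: equiv_norms_def)
  from assms(2) obtain c d where q: "c > 0" "d > 0" "\<And>x. c * norm x \<le> q x \<and> q x \<le> d * norm x"
    by (auto simp: equiv_norms_def)
  show ?thesis
  proof (rule that[of "c / b" "d / a"])
    fix x :: 'a assume x: "x \<noteq> 0"
    then have pos: "a * norm x > 0" using p by simp
    have "p x > 0" "q x \<ge> 0" "d * norm x \<ge> 0"
      using pos p(3)[of x] q(3)[of x] q(1,2) by (auto intro: order_trans[of 0 "c * norm x"])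
    then have "(c * norm x) / (b * norm x) \<le> q x / p x" "q x / p x \<le> (d * norm x) / (a * norm x)"
      using p(3)[of x] q(3)[of x] pos by (simp_all only: frac_le)
    then show "c / b \<le> q x / p x \<and> q x / p x \<le> d / a" using x by simp
  qed (use p q in auto)
qed

lemma log_metric_proj_class:
  fixes p q :: "'a::real_normed_vector \<Rightarrow> real"
  assumes nz: "\<exists>x::'a. x \<noteq> 0" and pq: "p \<in> equiv_norms" "q \<in> equiv_norms"
  shows "log_metric (proj_class p) (proj_class q) = log_dist p q"
  unfolding log_metric_def
proof (rule lift_proj_eq)
  fix a b :: real assume ab: "a > 0" "b > 0"
  let ?S = "(\<lambda>x. q x / p x) ` {x. x \<noteq> 0}"
  have img: "(\<lambda>x. (b *\<^sub>R q) x / (a *\<^sub>R p) x) ` {x. x \<noteq> 0} = (*) (b / a) ` ?S"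
    by (simp add: image_image mult.commute)
  have ne: "?S \<noteq> {}" using nz by blast
  have bdd: "bdd_above ?S" "bdd_below ?S"
    by (rule equiv_norms_ratio_bounds[OF pq]; auto simp: bdd_above_def bdd_below_def)+
  have "log_M (b *\<^sub>R q) (a *\<^sub>R p) = b / a * log_M q p"
    unfolding log_M_def img by (rule Sup_Inf_mult_pos(1)) (use ab ne bdd in auto)
  moreover have "log_m (b *\<^sub>R q) (a *\<^sub>R p) = b / a * log_m q p"
    unfolding log_m_def img by (rule Sup_Inf_mult_pos(2)) (use ab ne bdd in auto)
  ultimately show "log_dist (a *\<^sub>R p) (b *\<^sub>R q) = log_dist p q"
    using ab by (simp add: log_dist_def)
qed

end

theory Submission
  imports Defs
begin

text \<open>The order of \<open>nonneg_funs\<close> is the pointwise one, and a norm is positive off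
  the origin. Dividing by \<open>p x\<close> thus turns \<alpha> p \<le> q into: \<alpha> is a lower
  bound of the ratios q x / p x over nonzero x; dually, q \<le> \<beta> p says that \<beta> is an
  upper bound (\<open>cone_le_scaleR_left_iff\<close>, \<open>cone_le_scaleR_right_iff\<close>). The
  largest lower bound and the least upper bound are \<open>log_m\<close> and \<open>log_M\<close>.
  Equivalence of the norms keeps the ratios between two positive constants, so both are finite and
  positive, and restricting to positive \<alpha> and \<beta> changes neither extremum.\<close>

lemma equiv_norms_pos:
  assumes "p \<in> equiv_norms" "x \<noteq> 0"
  shows "p x > 0"
  using assms by (auto simp: equiv_norms_def is_norm_def less_le)

lemma equiv_norms_zero: "p \<in> equiv_norms \<Longrightarrow> p 0 = 0"
  by (auto simp: equiv_norms_def is_norm_def)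

lemma cone_le_nonneg_funs: "cone_le nonneg_funs u v \<longleftrightarrow> (\<forall>x. u x \<le> v x)"
  by (simp add: cone_le_def nonneg_funs_def)

text \<open>At the origin both norms vanish, so the inequality there is 0 \<le> 0 and only nonzero
  points constrain \<alpha>.\<close>

lemma cone_le_scaleR_left_iff:
  assumes "p \<in> equiv_norms" "q \<in> equiv_norms"
  shows "cone_le nonneg_funs (\<alpha> *\<^sub>R p) q \<longleftrightarrow> (\<forall>x\<in>{x. x \<noteq> 0}. \<alpha> \<le> q x / p x)"
proof -
  have "\<alpha> * p x \<le> q x \<longleftrightarrow> x = 0 \<or> \<alpha> \<le> q x / p x" for x
    using equiv_norms_pos[OF assms(1), of x] equiv_norms_zero[OF assms(1)]
      equiv_norms_zero[OF assms(2)]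
    by (cases "x = 0") (auto simp: pos_le_divide_eq)
  then show ?thesis by (auto simp: cone_le_nonneg_funs)
qed

lemma cone_le_scaleR_right_iff:
  assumes "p \<in> equiv_norms" "q \<in> equiv_norms"
  shows "cone_le nonneg_funs q (\<beta> *\<^sub>R p) \<longleftrightarrow> (\<forall>x\<in>{x. x \<noteq> 0}. q x / p x \<le> \<beta>)"
proof -
  have "q x \<le> \<beta> * p x \<longleftrightarrow> x = 0 \<or> q x / p x \<le> \<beta>" for x
    using equiv_norms_pos[OF assms(1), of x] equiv_norms_zero[OF assms(1)]
      equiv_norms_zero[OF assms(2)]
    by (cases "x = 0") (auto simp: pos_divide_le_eq)
  then show ?thesis by (auto simp: cone_le_nonneg_funs)
qed

context
  fixes p q :: "'a::real_normed_vector \<Rightarrow> real"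
  assumes nontrivial: "\<exists>x::'a. x \<noteq> 0" and pq: "p \<in> equiv_norms" "q \<in> equiv_norms"
begin

text \<open>This rules out the infinite value of \<open>hilbert_dist\<close>. The bounds on the
  ratios serve as \<alpha> and \<beta>.\<close>

lemma cone_comparable_equiv_norms: "cone_comparable nonneg_funs p q"
proof -
  obtain a b where ab: "a > 0" "b > 0" "\<And>x. x \<noteq> 0 \<Longrightarrow> a \<le> q x / p x \<and> q x / p x \<le> b"
    using equiv_norms_ratio_bounds[OF pq] by blast
  have "cone_le nonneg_funs (a *\<^sub>R p) q" "cone_le nonneg_funs q (b *\<^sub>R p)"
    using ab(3) by (simp_all add: cone_le_scaleR_left_iff[OF pq] cone_le_scaleR_right_iff[OF pq])
  moreover have "p \<in> nonneg_funs" "q \<in> nonneg_funs"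
    using pq by (auto simp: equiv_norms_def is_norm_def nonneg_funs_def)
  moreover obtain x :: 'a where "x \<noteq> 0" using nontrivial by blast
  then have "p \<noteq> 0" "q \<noteq> 0"
    using equiv_norms_pos[OF pq(1), of x] equiv_norms_pos[OF pq(2), of x] by auto
  ultimately show ?thesis using ab(1,2) unfolding cone_comparable_def by blast
qed

lemma cone_m_eq_log_m: "cone_m nonneg_funs q p = log_m q p"
proof -
  obtain a b where ab: "a > 0" "\<And>x. x \<noteq> 0 \<Longrightarrow> a \<le> q x / p x \<and> q x / p x \<le> b"
    using equiv_norms_ratio_bounds[OF pq] by metis
  have ne: "{x::'a. x \<noteq> 0} \<noteq> {}" using nontrivial by blast
  have bdd: "bdd_below ((\<lambda>x. q x / p x) ` {x. x \<noteq> 0})"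
    using ab by (auto simp: bdd_below_def)
  \<comment> \<open>Positivity of each ratio would not make the infimum positive; the uniform bound
    \<open>a\<close> does.\<close>
  have "a \<le> log_m q p"
    unfolding log_m_def by (rule cINF_greatest[OF ne]) (use ab in auto)
  with ab have "log_m q p > 0" by simp
  \<comment> \<open>Lower bounds are exactly the numbers below the infimum. As
    \<open>log_m q p\<close> is positive, this interval is nonempty and its supremum is its right
    endpoint.\<close>
  moreover have "{\<alpha>. \<alpha> > 0 \<and> cone_le nonneg_funs (\<alpha> *\<^sub>R p) q} = {0<..log_m q p}"
    unfolding cone_le_scaleR_left_iff[OF pq] log_m_def le_cINF_iff[OF ne bdd, symmetric]
    by auto
  ultimately show ?thesis by (simp add: cone_m_def)
qed

lemma cone_M_eq_log_M: "cone_M nonneg_funs q p = log_M q p"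
proof -
  obtain a b where ab: "a > 0" "\<And>x. x \<noteq> 0 \<Longrightarrow> a \<le> q x / p x \<and> q x / p x \<le> b"
    using equiv_norms_ratio_bounds[OF pq] by metis
  have ne: "{x::'a. x \<noteq> 0} \<noteq> {}" using nontrivial by blast
  have bdd: "bdd_above ((\<lambda>x. q x / p x) ` {x. x \<noteq> 0})"
    using ab by (auto simp: bdd_above_def)
  \<comment> \<open>One nonzero point makes \<open>log_M q p\<close> positive, so every upper bound
    of the ratios satisfies \<beta> > 0 automatically.\<close>
  obtain x :: 'a where x: "x \<noteq> 0" using nontrivial by blast
  then have "a \<le> q x / p x" using ab by blast
  also have "\<dots> \<le> log_M q p"
    unfolding log_M_def by (rule cSUP_upper[OF _ bdd]) (use x in simp)
  finally have "log_M q p > 0" using ab by simp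
  then have "{\<beta>. \<beta> > 0 \<and> cone_le nonneg_funs q (\<beta> *\<^sub>R p)} = {log_M q p..}"
    unfolding cone_le_scaleR_right_iff[OF pq] log_M_def cSUP_le_iff[OF ne bdd, symmetric]
    by auto
  then show ?thesis by (simp add: cone_M_def)
qed

text \<open>Both metrics are invariant under positive scaling, so they may be evaluated at the
  representatives \<open>p\<close> and \<open>q\<close>.\<close>

lemma hilbert_metric_eq_log_metric:
  "hilbert_metric nonneg_funs (proj_class p) (proj_class q) =
   ereal (log_metric (proj_class p) (proj_class q))"
  by (simp add: hilbert_metric_proj_class[OF pointed_convex_cone_nonneg_funs]
      log_metric_proj_class[OF nontrivial pq] hilbert_dist_def log_dist_def
      cone_comparable_equiv_norms cone_m_eq_log_m cone_M_eq_log_M)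

end

theorem proposition2p9:
  assumes "\<exists>x::'a::banach. x \<noteq> 0"
  shows "(\<forall>p\<in>equiv_norms. \<forall>q\<in>equiv_norms.
            cone_comparable nonneg_funs p (q :: 'a \<Rightarrow> real) \<and>
            cone_M nonneg_funs q p = log_M q p \<and>
            cone_m nonneg_funs q p = log_m q p) \<and>
         (\<forall>p\<in>equiv_norms. \<forall>q\<in>equiv_norms.
            hilbert_metric nonneg_funs (proj_class p) (proj_class (q :: 'a \<Rightarrow> real)) =
            ereal (log_metric (proj_class p) (proj_class q))) \<and>
         (\<forall>P\<in>proj_equiv_norms. \<forall>Q\<in>proj_equiv_norms.
            hilbert_metric nonneg_funs P (Q :: ('a \<Rightarrow> real) set) = ereal (log_metric P Q))"
  \<comment> \<open>Each element of \<open>proj_equiv_norms\<close> is the class of an equivalent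
    norm, which reduces the last conjunct to the second.\<close>
  using cone_comparable_equiv_norms[OF assms] cone_M_eq_log_M[OF assms]
    cone_m_eq_log_m[OF assms] hilbert_metric_eq_log_metric[OF assms]
  by (auto simp: proj_equiv_norms_def proj_class_def elim!: quotientE)

end
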